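(* Let $X$ and $Y$ be random variables with values in $\{0,1,2,\dots\}$. Then $X$ and $Y$ have distributions of the same D-type (with constant $c\in(0,1)$) if and only if $X\stackrel{d}{=}\sum_{i=1}^{Y}Z_i$ for some i.i.d. Bernoulli random variables $\{Z_i\}$ independent of $Y$, the Bernoulli probability being $P(Z_i=1)=c$.
   Context: Let $P_1$, $P_2$ be the probability generating functions of $X$ and $Y$ respectively. $X$ and $Y$ have distributions of the same D-type with constant $c\in(0,1)$ if $P_1(1-s)=P_2(1-cs)$ for all $0<s<1$. An empty sum is $0$. *)

theory Defs
  imports "HOL-Probability.Probability"
begin

definition pgf :: "'a measure \<Rightarrow> ('a \<Rightarrow> nat) \<Rightarrow> real \<Rightarrow> real" where
  "pgf M X s = (LINT \<omega>|M. s ^ X \<omega>)"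

definition same_D_type ::
  "real \<Rightarrow> 'a measure \<Rightarrow> ('a \<Rightarrow> nat) \<Rightarrow> 'b measure \<Rightarrow> ('b \<Rightarrow> nat) \<Rightarrow> bool" where
  "same_D_type c M X N Y \<longleftrightarrow>
     0 < c \<and> c < 1 \<and> (\<forall>s. 0 < s \<and> s < 1 \<longrightarrow> pgf M X (1 - s) = pgf N Y (1 - c * s))"

text \<open>
  The space on which Y lives need not be rich enough to carry an i.i.d. sequence independent
  of Y, so auxiliary random variables are taken on an extension of it: a probability space
  with a measure-preserving map \<open>\<pi>\<close> to the given one. A random variable Y on N is then
  identified with \<open>Y \<circ> \<pi>\<close>. The identity map makes every probability space an extension of itself.
\<close>

definition prob_extension :: "'w measure \<Rightarrow> ('w \<Rightarrow> 'b) \<Rightarrow> 'b measure \<Rightarrow> bool" where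
  "prob_extension W \<pi> N \<longleftrightarrow> prob_space W \<and> \<pi> \<in> W \<rightarrow>\<^sub>M N \<and> distr W N \<pi> = N"

definition iid_bernoulli :: "real \<Rightarrow> 'w measure \<Rightarrow> (nat \<Rightarrow> 'w \<Rightarrow> nat) \<Rightarrow> bool" where
  "iid_bernoulli c W Z \<longleftrightarrow>
     prob_space.indep_vars W (\<lambda>_. count_space UNIV) Z {1..} \<and>
     (\<forall>i\<in>{1..}. distr W (count_space UNIV) (Z i) = measure_pmf (map_pmf of_bool (bernoulli_pmf c)))"

text \<open>
  Independence of two random variables with values in different types, which the library's
  \<open>indep_var\<close> does not cover: the generated sigma-algebras are independent.
\<close>

definition indep_rv ::
  "'w measure \<Rightarrow> 'u measure \<Rightarrow> ('w \<Rightarrow> 'u) \<Rightarrow> 'v measure \<Rightarrow> ('w \<Rightarrow> 'v) \<Rightarrow> bool" where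
  "indep_rv W S U T V \<longleftrightarrow>
     U \<in> W \<rightarrow>\<^sub>M S \<and> V \<in> W \<rightarrow>\<^sub>M T \<and>
     prob_space.indep_set W (sets (vimage_algebra (space W) U S)) (sets (vimage_algebra (space W) V T))"

text \<open>
  \<open>Y\<close> is independent of the whole sequence \<open>Z\<close>, not merely of each term.
\<close>

definition bernoulli_sum_repr ::
  "real \<Rightarrow> 'a measure \<Rightarrow> ('a \<Rightarrow> nat) \<Rightarrow> 'w measure \<Rightarrow> ('w \<Rightarrow> nat) \<Rightarrow> bool" where
  "bernoulli_sum_repr c M X W Y \<longleftrightarrow>
     (\<exists>Z. iid_bernoulli c W Z \<and>
          indep_rv W (count_space UNIV) Y
            (\<Pi>\<^sub>M i\<in>{1..}. count_space UNIV) (\<lambda>\<omega>. \<lambda>i\<in>{1..}. Z i \<omega>) \<and>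
          distr M (count_space UNIV) X =
            distr W (count_space UNIV) (\<lambda>\<omega>. \<Sum>i = 1..Y \<omega>. Z i \<omega>))"

end

theory Submission
  imports Defs "HOL-Complex_Analysis.Cauchy_Integral_Formula"
begin

text \<open>
  Splitting over the events \<open>Y = n\<close> and using independence, the sum of \<open>Y\<close> Bernoulli variables
  has generating function \<open>t \<mapsto> P\<^sub>2(1 - c + c * t)\<close>, which is \<open>P\<^sub>2(1 - c * s)\<close> at \<open>t = 1 - s\<close>.
  Hence a representation of \<open>X\<close> gives the D-type identity. Conversely, an independent
  Bernoulli sequence exists on the product of \<open>N\<close> with a sequence space; the D-type identity then
  makes the generating functions of \<open>X\<close> and of the random sum agree on (0,1), and power series
  coefficients are determined by the values there.
\<close>

section \<open>Generating functions as power series, and their uniqueness\<close>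

text \<open>The partial sums integrate \<open>f\<close> over \<open>U < n\<close>, so dominated
  convergence with bound \<open>\<bar>f\<bar>\<close> gives the limit. It serves both to expand a
  generating function and to split a random sum by its number of terms.\<close>

lemma integral_level_sets_sums:
  fixes U :: "'a \<Rightarrow> nat" and f :: "'a \<Rightarrow> real"
  assumes [measurable]: "U \<in> M \<rightarrow>\<^sub>M count_space UNIV" and int: "integrable M f"
  shows "(\<lambda>n. LINT \<omega>|M. of_bool (U \<omega> = n) * f \<omega>) sums (LINT \<omega>|M. f \<omega>)"
proof -
  have [measurable]: "f \<in> borel_measurable M"
    using int by auto
  have int': "integrable M (\<lambda>\<omega>. of_bool (U \<omega> = n) * f \<omega>)" for n
    by (rule Bochner_Integration.integrable_bound[OF int]) auto
  have partial: "(\<Sum>k<n. of_bool (U \<omega> = k) * f \<omega>) = of_bool (U \<omega> < n) * f \<omega>" for n \<omega>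
    by (auto simp: sum_distrib_right[symmetric] of_bool_def)
  have "(\<lambda>n. LINT \<omega>|M. of_bool (U \<omega> < n) * f \<omega>) \<longlonglongrightarrow> (LINT \<omega>|M. f \<omega>)"
  proof (rule integral_dominated_convergence[where w = "\<lambda>\<omega>. \<bar>f \<omega>\<bar>"])
    have "(\<lambda>n. of_bool (U \<omega> < n) * f \<omega>) \<longlonglongrightarrow> f \<omega>" for \<omega>
      by (rule tendsto_eventually, rule eventually_sequentiallyI[of "Suc (U \<omega>)"]) auto
    then show "AE \<omega> in M. (\<lambda>n. of_bool (U \<omega> < n) * f \<omega>) \<longlonglongrightarrow> f \<omega>"
      by simp
  qed (use int in auto)
  then show ?thesis
    by (simp add: sums_def Bochner_Integration.integral_sum[OF int', symmetric] partial)
qed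

lemma (in prob_space) pgf_sums:
  fixes U :: "'a \<Rightarrow> nat"
  assumes [measurable]: "U \<in> M \<rightarrow>\<^sub>M count_space UNIV" and "\<bar>t\<bar> \<le> 1"
  shows "(\<lambda>n. prob {\<omega> \<in> space M. U \<omega> = n} * t ^ n) sums pgf M U t"
proof -
  have "integrable M (\<lambda>\<omega>. t ^ U \<omega>)"
    using \<open>\<bar>t\<bar> \<le> 1\<close> by (intro integrable_const_bound[where B = 1]) (auto simp: power_abs power_le_one)
  moreover have "(LINT \<omega>|M. of_bool (U \<omega> = n) * t ^ U \<omega>) = prob {\<omega> \<in> space M. U \<omega> = n} * t ^ n" for n
  proof -
    have "(LINT \<omega>|M. of_bool (U \<omega> = n) * t ^ U \<omega>)
        = (LINT \<omega>|M. indicator {\<omega> \<in> space M. U \<omega> = n} \<omega> * t ^ n)"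
      by (rule Bochner_Integration.integral_cong) (auto split: split_indicator)
    also have "\<dots> = prob {\<omega> \<in> space M. U \<omega> = n} * t ^ n"
      by (simp add: Int_def conj_commute conj_left_commute)
    finally show ?thesis .
  qed
  ultimately show ?thesis
    using integral_level_sets_sums[of U M "\<lambda>\<omega>. t ^ U \<omega>"] by (simp add: pgf_def)
qed

text \<open>A power series with a nonzero coefficient cannot have zeros accumulating at 0, whereas
  here every point of (0,1) is a zero.\<close>

lemma powser_eq_zero_imp_coeff_eq_zero:
  fixes a :: "nat \<Rightarrow> real"
  assumes summable: "\<And>t. \<bar>t\<bar> < 1 \<Longrightarrow> summable (\<lambda>n. a n * t ^ n)"
    and zero: "\<And>t. 0 < t \<Longrightarrow> t < 1 \<Longrightarrow> (\<Sum>n. a n * t ^ n) = 0"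
  shows "a m = 0"
proof (rule ccontr)
  assume "a m \<noteq> 0"
  \<comment> \<open>The extra factor \<open>t\<close> makes the function vanish at 0, as \<open>powser_0_nonzero\<close> requires.\<close>
  define f where "f t = t * (\<Sum>n. a n * t ^ n)" for t :: real
  define b where "b n = (case n of 0 \<Rightarrow> 0 | Suc k \<Rightarrow> a k)" for n
  have "(\<lambda>n. b n * (t - 0) ^ n) sums f t" if "norm (t - 0) < 1" for t
  proof -
    have "(\<lambda>n. t * (a n * t ^ n)) sums f t"
      unfolding f_def using summable that by (intro sums_mult summable_sums) auto
    then have "(\<lambda>n. b (Suc n) * t ^ Suc n) sums f t"
      by (simp add: b_def algebra_simps)
    then show ?thesis
      by (subst (asm) sums_Suc_iff) (simp add: b_def)
  qed
  moreover have "f 0 = 0" "b (Suc m) \<noteq> 0"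
    using \<open>a m \<noteq> 0\<close> by (simp_all add: f_def b_def)
  ultimately obtain s where "0 < s" and s: "\<And>z. z \<in> cball 0 s - {0} \<Longrightarrow> f z \<noteq> 0"
    using powser_0_nonzero[of 1 0 b f "Suc m"] by auto
  \<comment> \<open>This point lies both in the punctured ball of radius \<open>s\<close> and in
    (0,1), where the series vanishes.\<close>
  have "f (min s (1/2)) \<noteq> 0"
    using \<open>0 < s\<close> by (intro s) auto
  then show False
    using zero[of "min s (1/2)"] \<open>0 < s\<close> by (simp add: f_def)
qed

text \<open>The difference of the generating functions is a power series on (-1,1) whose
  coefficients are the differences of the point masses. Point masses determine a law on the
  naturals.\<close>

lemma pgf_eq_imp_distr_eq:
  fixes U :: "'a \<Rightarrow> nat" and V :: "'b \<Rightarrow> nat"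
  assumes "prob_space M" "prob_space N"
    and [measurable]: "U \<in> M \<rightarrow>\<^sub>M count_space UNIV" "V \<in> N \<rightarrow>\<^sub>M count_space UNIV"
    and eq: "\<And>t. 0 < t \<Longrightarrow> t < 1 \<Longrightarrow> pgf M U t = pgf N V t"
  shows "distr M (count_space UNIV) U = distr N (count_space UNIV) V"
proof -
  interpret M: prob_space M by fact
  interpret N: prob_space N by fact
  let ?p = "\<lambda>n. M.prob {\<omega> \<in> space M. U \<omega> = n}"
  let ?q = "\<lambda>n. N.prob {\<omega> \<in> space N. V \<omega> = n}"
  have sums: "(\<lambda>n. (?p n - ?q n) * t ^ n) sums (pgf M U t - pgf N V t)" if "\<bar>t\<bar> < 1" for t
    using sums_diff[OF M.pgf_sums[of U t] N.pgf_sums[of V t]] that by (simp add: left_diff_distrib)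
  have "?p n - ?q n = 0" for n
  proof (rule powser_eq_zero_imp_coeff_eq_zero[where a = "\<lambda>n. ?p n - ?q n"])
    show "summable (\<lambda>n. (?p n - ?q n) * t ^ n)" if "\<bar>t\<bar> < 1" for t
      using sums[OF that] by (rule sums_summable)
    show "(\<Sum>n. (?p n - ?q n) * t ^ n) = 0" if "0 < t" "t < 1" for t
      using sums[of t] eq[OF that] that by (simp add: sums_iff)
  qed
  then have "?p n = ?q n" for n
    by simp
  then show ?thesis
    by (intro measure_eqI_countable[where A = UNIV])
      (auto simp: emeasure_distr vimage_def Int_def conj_commute
        M.emeasure_eq_measure N.emeasure_eq_measure)
qed

section \<open>Independence and the generating function of a random sum\<close>

text \<open>\<open>h\<close> after \<open>W\<close> is measurable for the sigma-algebra generated by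
  \<open>W\<close>. Thus independence of generated sigma-algebras passes to functions of the
  variables.\<close>

lemma sigma_sets_compose_subset_vimage_algebra:
  assumes "W \<in> M \<rightarrow>\<^sub>M R" "h \<in> R \<rightarrow>\<^sub>M L"
  shows "sigma_sets (space M) {(\<lambda>\<omega>. h (W \<omega>)) -` A \<inter> space M |A. A \<in> sets L}
    \<subseteq> sets (vimage_algebra (space M) W R)"
proof -
  have "W \<in> vimage_algebra (space M) W R \<rightarrow>\<^sub>M R"
    using measurable_space[OF assms(1)] by (intro measurable_vimage_algebra1) auto
  then have "(\<lambda>\<omega>. h (W \<omega>)) \<in> vimage_algebra (space M) W R \<rightarrow>\<^sub>M L"
    using assms(2) by (rule measurable_compose)
  then show ?thesis
    unfolding sets_vimage_algebra[symmetric] by (intro sets_image_in_sets) auto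
qed

text \<open>After composition with \<open>f\<close> and \<open>g\<close> both variables are
  real-valued, so \<open>indep_var\<close> and its product rule apply even when \<open>U\<close> and
  \<open>V\<close> have different value types.\<close>

lemma (in prob_space) indep_rv_lebesgue_integral:
  fixes f g :: "_ \<Rightarrow> real"
  assumes indep: "indep_rv M S U T V"
    and f [measurable]: "f \<in> borel_measurable S" and g [measurable]: "g \<in> borel_measurable T"
    and "integrable M (\<lambda>\<omega>. f (U \<omega>))" "integrable M (\<lambda>\<omega>. g (V \<omega>))"
  shows "(LINT \<omega>|M. f (U \<omega>) * g (V \<omega>)) = (LINT \<omega>|M. f (U \<omega>)) * (LINT \<omega>|M. g (V \<omega>))"
proof (rule indep_var_lebesgue_integral)
  have [measurable]: "U \<in> M \<rightarrow>\<^sub>M S" "V \<in> M \<rightarrow>\<^sub>M T"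
    and *: "indep_set (sets (vimage_algebra (space M) U S)) (sets (vimage_algebra (space M) V T))"
    using indep by (auto simp: indep_rv_def)
  show "indep_var borel (\<lambda>\<omega>. f (U \<omega>)) borel (\<lambda>\<omega>. g (V \<omega>))"
    unfolding indep_var_eq
  proof (intro conjI)
    show "indep_set
        (sigma_sets (space M) {(\<lambda>\<omega>. f (U \<omega>)) -` A \<inter> space M |A. A \<in> sets borel})
        (sigma_sets (space M) {(\<lambda>\<omega>. g (V \<omega>)) -` A \<inter> space M |A. A \<in> sets borel})"
      using * sigma_sets_compose_subset_vimage_algebra[OF \<open>U \<in> _\<close> f]
        sigma_sets_compose_subset_vimage_algebra[OF \<open>V \<in> _\<close> g]
      unfolding indep_sets2_eq by (meson subset_iff)
  qed measurable
qed fact+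

text \<open>The power of the sum is a product of independent factors, each with mean (1 - c) * 1 + c
  * t.\<close>

lemma (in prob_space) pgf_iid_bernoulli_sum:
  assumes iid: "iid_bernoulli c M Z" and "0 \<le> c" "c \<le> 1" "0 \<le> t" "t \<le> 1"
  shows "pgf M (\<lambda>\<omega>. \<Sum>i = 1..n. Z i \<omega>) t = (1 - c + c * t) ^ n"
proof -
  have indep: "indep_vars (\<lambda>_. count_space UNIV) Z {1..}"
    and distr: "\<And>i. i \<ge> 1 \<Longrightarrow>
      distr M (count_space UNIV) (Z i) = measure_pmf (map_pmf of_bool (bernoulli_pmf c))"
    using iid by (auto simp: iid_bernoulli_def)
  have [measurable]: "Z i \<in> M \<rightarrow>\<^sub>M count_space UNIV" if "i \<ge> 1" for i
    using indep that by (auto simp: indep_vars_def)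
  have "(LINT \<omega>|M. t ^ Z i \<omega>) = 1 - c + c * t" if "i \<ge> 1" for i
  proof -
    have "(LINT \<omega>|M. t ^ Z i \<omega>) = (LINT k|distr M (count_space UNIV) (Z i). t ^ k)"
      using that by (subst integral_distr) auto
    also have "\<dots> = 1 - c + c * t"
      using assms by (simp add: distr[OF that])
    finally show ?thesis .
  qed
  moreover have "(LINT \<omega>|M. (\<Prod>i = 1..n. t ^ Z i \<omega>)) = (\<Prod>i = 1..n. LINT \<omega>|M. t ^ Z i \<omega>)"
  proof (rule indep_vars_lebesgue_integral)
    show "indep_vars (\<lambda>_. borel) (\<lambda>i \<omega>. t ^ Z i \<omega>) {1..n}"
      by (rule indep_vars_compose2[OF indep_vars_subset[OF indep]]) auto
    show "integrable M (\<lambda>\<omega>. t ^ Z i \<omega>)" if "i \<in> {1..n}" for i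
      using that assms by (intro integrable_const_bound[where B = 1]) (auto simp: power_le_one)
  qed auto
  ultimately show ?thesis
    by (simp add: pgf_def power_sum)
qed

text \<open>On \<open>U = n\<close> the sum has a fixed length and is a function of the sequence
  alone, so independence from the whole sequence factorises each term of the split integral.\<close>

lemma (in prob_space) bernoulli_random_sum:
  assumes iid: "iid_bernoulli c M Z"
    and indep: "indep_rv M (count_space UNIV) U
      (\<Pi>\<^sub>M i\<in>{1..}. count_space UNIV) (\<lambda>\<omega>. \<lambda>i\<in>{1..}. Z i \<omega>)"
    and c: "0 \<le> c" "c \<le> 1"
  shows measurable_bernoulli_random_sum:
      "(\<lambda>\<omega>. \<Sum>i = 1..U \<omega>. Z i \<omega>) \<in> M \<rightarrow>\<^sub>M count_space UNIV" (is "?S \<in> _")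
    and pgf_bernoulli_random_sum: "0 \<le> t \<Longrightarrow> t \<le> 1 \<Longrightarrow>
      pgf M (\<lambda>\<omega>. \<Sum>i = 1..U \<omega>. Z i \<omega>) t = pgf M U (1 - c + c * t)"
proof -
  have [measurable]: "U \<in> M \<rightarrow>\<^sub>M count_space UNIV"
    using indep by (auto simp: indep_rv_def)
  have "Z i \<in> M \<rightarrow>\<^sub>M count_space UNIV" if "i \<ge> 1" for i
    using iid that by (auto simp: iid_bernoulli_def indep_vars_def)
  then have S_n [measurable]: "(\<lambda>\<omega>. \<Sum>i = 1..n. Z i \<omega>) \<in> M \<rightarrow>\<^sub>M count_space UNIV" for n
    by (intro measurable_sum_nat) auto
  show S [measurable]: "?S \<in> M \<rightarrow>\<^sub>M count_space UNIV"
    \<comment> \<open>The sum is glued from countably many fixed-length sums, selected by the value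
      of \<open>U\<close>.\<close>
    by (rule measurable_compose_countable[where g = U and f = "\<lambda>n \<omega>. \<Sum>i = 1..n. Z i \<omega>"])
      (use S_n in \<open>auto simp del: One_nat_def\<close>)
  assume t: "0 \<le> t" "t \<le> 1"
  have bounded: "integrable M (\<lambda>\<omega>. t ^ V \<omega>)" if "V \<in> M \<rightarrow>\<^sub>M count_space UNIV" for V
    using that t by (intro integrable_const_bound[where B = 1]) (auto simp: power_le_one)
  have "(LINT \<omega>|M. of_bool (U \<omega> = n) * t ^ ?S \<omega>)
      = prob {\<omega> \<in> space M. U \<omega> = n} * (1 - c + c * t) ^ n" for n
  proof -
    let ?g = "\<lambda>z. t ^ (\<Sum>i = 1..n. z i)"
    \<comment> \<open>\<open>?g\<close> reads only coordinates in \<open>{1..n}\<close>, where the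
      restricted sequence agrees with \<open>Z\<close>.\<close>
    have Z: "?g (\<lambda>i\<in>{1..}. Z i \<omega>) = t ^ (\<Sum>i = 1..n. Z i \<omega>)" for \<omega>
      by (intro arg_cong[where f = "(^) t"] sum.cong) auto
    have "(LINT \<omega>|M. of_bool (U \<omega> = n) * t ^ ?S \<omega>)
        = (LINT \<omega>|M. of_bool (U \<omega> = n) * ?g (\<lambda>i\<in>{1..}. Z i \<omega>))"
      unfolding Z by (rule Bochner_Integration.integral_cong) auto
    also have "\<dots> = (LINT \<omega>|M. of_bool (U \<omega> = n)) * (LINT \<omega>|M. ?g (\<lambda>i\<in>{1..}. Z i \<omega>))"
    proof (rule indep_rv_lebesgue_integral[OF indep, where f = "\<lambda>k. of_bool (k = n)" and g = ?g])
      have "(\<lambda>z. \<Sum>i = 1..n. z i) \<in> (\<Pi>\<^sub>M i\<in>{1..}. count_space UNIV) \<rightarrow>\<^sub>M count_space (UNIV :: nat set)"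
        by (intro measurable_sum_nat measurable_component_singleton) auto
      then show "?g \<in> borel_measurable (\<Pi>\<^sub>M i\<in>{1..}. count_space UNIV)"
        by (rule measurable_compose) auto
      show "integrable M (\<lambda>\<omega>. ?g (\<lambda>i\<in>{1..}. Z i \<omega>))"
        unfolding Z by (rule bounded[OF S_n])
      show "integrable M (\<lambda>\<omega>. of_bool (U \<omega> = n) :: real)"
        by (intro integrable_const_bound[where B = 1]) auto
    qed auto
    also have "(LINT \<omega>|M. of_bool (U \<omega> = n)) = prob {\<omega> \<in> space M. U \<omega> = n}"
      by (subst Bochner_Integration.integral_cong[OF refl, where g = "indicator {\<omega> \<in> space M. U \<omega> = n}"])
        (auto simp: Int_def conj_commute conj_left_commute split: split_indicator)
    also have "(LINT \<omega>|M. ?g (\<lambda>i\<in>{1..}. Z i \<omega>)) = (1 - c + c * t) ^ n"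
      unfolding Z using pgf_iid_bernoulli_sum[OF iid c t] by (simp add: pgf_def)
    finally show ?thesis .
  qed
  then have "(\<lambda>n. prob {\<omega> \<in> space M. U \<omega> = n} * (1 - c + c * t) ^ n) sums pgf M ?S t"
    using integral_level_sets_sums[OF \<open>U \<in> _\<close> bounded[OF S]] by (simp add: pgf_def)
  \<comment> \<open>The argument is a convex combination of 1 and \<open>t\<close>, so
    \<open>pgf_sums\<close> applies there and yields the same series.\<close>
  moreover have "\<bar>1 - c + c * t\<bar> \<le> 1"
    using c t mult_left_mono[of t 1 c] by (auto simp: abs_le_iff)
  ultimately show "pgf M ?S t = pgf M U (1 - c + c * t)"
    using sums_unique2 pgf_sums[OF \<open>U \<in> _\<close>] by blast
qed

section \<open>From a random-sum representation to the D-type identity\<close>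

lemma pgf_distr:
  "V \<in> M \<rightarrow>\<^sub>M count_space UNIV \<Longrightarrow> pgf (distr M (count_space UNIV) V) (\<lambda>n. n) t = pgf M V t"
  unfolding pgf_def by (subst integral_distr) auto

lemma pgf_prob_extension:
  assumes "prob_extension W \<pi> N" "Y \<in> N \<rightarrow>\<^sub>M count_space UNIV"
  shows "pgf W (Y \<circ> \<pi>) t = pgf N Y t"
proof -
  have "\<pi> \<in> W \<rightarrow>\<^sub>M N" "distr W N \<pi> = N"
    using assms by (auto simp: prob_extension_def)
  then show ?thesis
    unfolding pgf_def using assms(2) integral_distr[of \<pi> W N "\<lambda>\<omega>. t ^ Y \<omega>"] by simp
qed

text \<open>The carrier type of \<open>W\<close> is arbitrary, so one proof covers both the product
  carrier and the type \<open>'w\<close> of the theorem.\<close>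

lemma bernoulli_sum_repr_imp_same_D_type:
  assumes ext: "prob_extension W \<pi> N" and repr: "bernoulli_sum_repr c M X W (Y \<circ> \<pi>)"
    and [measurable]: "X \<in> M \<rightarrow>\<^sub>M count_space UNIV" "Y \<in> N \<rightarrow>\<^sub>M count_space UNIV"
    and c: "0 < c" "c < 1"
  shows "same_D_type c M X N Y"
  unfolding same_D_type_def
proof (intro conjI allI impI)
  fix s :: real assume s: "0 < s \<and> s < 1"
  interpret W: prob_space W
    using ext by (simp add: prob_extension_def)
  from repr obtain Z where Z: "iid_bernoulli c W Z"
      "indep_rv W (count_space UNIV) (Y \<circ> \<pi>) (\<Pi>\<^sub>M i\<in>{1..}. count_space UNIV) (\<lambda>\<omega>. \<lambda>i\<in>{1..}. Z i \<omega>)"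
    and eq: "distr M (count_space UNIV) X =
      distr W (count_space UNIV) (\<lambda>\<omega>. \<Sum>i = 1..(Y \<circ> \<pi>) \<omega>. Z i \<omega>)"
    unfolding bernoulli_sum_repr_def by blast
  have S: "(\<lambda>\<omega>. \<Sum>i = 1..(Y \<circ> \<pi>) \<omega>. Z i \<omega>) \<in> W \<rightarrow>\<^sub>M count_space UNIV"
    using c by (intro W.measurable_bernoulli_random_sum[OF Z]) auto
  \<comment> \<open>A generating function is that of the identity under the law of the variable, so
    equal laws give equal values.\<close>
  have "pgf M X (1 - s) = pgf W (\<lambda>\<omega>. \<Sum>i = 1..(Y \<circ> \<pi>) \<omega>. Z i \<omega>) (1 - s)"
    using arg_cong[OF eq, of "\<lambda>D. pgf D (\<lambda>n. n) (1 - s)"]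
    unfolding pgf_distr[OF assms(3)] pgf_distr[OF S] .
  also have "\<dots> = pgf W (Y \<circ> \<pi>) (1 - c + c * (1 - s))"
    using W.pgf_bernoulli_random_sum[OF Z] c s by simp
  also have "\<dots> = pgf N Y (1 - c * s)"
    by (simp add: pgf_prob_extension[OF ext assms(4)] algebra_simps)
  finally show "pgf M X (1 - s) = pgf N Y (1 - c * s)" .
qed (use c in auto)

section \<open>A product extension carrying an independent Bernoulli sequence\<close>

text \<open>Events of the two variables are rectangles \<open>A \<times> space P\<close> and
  \<open>space N \<times> B\<close>, whose intersection has product measure.\<close>

lemma indep_rv_pair_measure:
  assumes "prob_space N" "prob_space P"
    and [measurable]: "Y \<in> N \<rightarrow>\<^sub>M S" "V \<in> P \<rightarrow>\<^sub>M T"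
  shows "indep_rv (N \<Otimes>\<^sub>M P) S (\<lambda>\<omega>. Y (fst \<omega>)) T (\<lambda>\<omega>. V (snd \<omega>))"
proof -
  interpret N: prob_space N by fact
  interpret P: prob_space P by fact
  interpret W: pair_prob_space N P ..
  let ?U = "\<lambda>\<omega>. Y (fst \<omega>)" and ?V = "\<lambda>\<omega>. V (snd \<omega>)"
  have m [measurable]: "?U \<in> N \<Otimes>\<^sub>M P \<rightarrow>\<^sub>M S" "?V \<in> N \<Otimes>\<^sub>M P \<rightarrow>\<^sub>M T"
    by measurable
  \<comment> \<open>Preimages already form a sigma-algebra, so every generated event is a single
    preimage.\<close>
  have sets:
      "sets (vimage_algebra (space (N \<Otimes>\<^sub>M P)) ?U S) = {?U -` A \<inter> space (N \<Otimes>\<^sub>M P) |A. A \<in> sets S}"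
      "sets (vimage_algebra (space (N \<Otimes>\<^sub>M P)) ?V T) = {?V -` A \<inter> space (N \<Otimes>\<^sub>M P) |A. A \<in> sets T}"
    using m[THEN measurable_space] by (auto intro!: sets_vimage_algebra2)
  have "W.prob ((?U -` A \<inter> space (N \<Otimes>\<^sub>M P)) \<inter> (?V -` B \<inter> space (N \<Otimes>\<^sub>M P)))
      = W.prob (?U -` A \<inter> space (N \<Otimes>\<^sub>M P)) * W.prob (?V -` B \<inter> space (N \<Otimes>\<^sub>M P))"
    if [measurable]: "A \<in> sets S" "B \<in> sets T" for A B
  proof -
    let ?A = "Y -` A \<inter> space N" and ?B = "V -` B \<inter> space P"
    have "(?U -` A \<inter> space (N \<Otimes>\<^sub>M P)) \<inter> (?V -` B \<inter> space (N \<Otimes>\<^sub>M P)) = ?A \<times> ?B"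
      "?U -` A \<inter> space (N \<Otimes>\<^sub>M P) = ?A \<times> space P" "?V -` B \<inter> space (N \<Otimes>\<^sub>M P) = space N \<times> ?B"
      by (auto simp: space_pair_measure)
    moreover have "W.prob (C \<times> D) = N.prob C * P.prob D" if "C \<in> sets N" "D \<in> sets P" for C D
      using that by (simp add: measure_def P.emeasure_pair_measure_Times enn2real_mult)
    ultimately show ?thesis
      by (simp add: N.prob_space P.prob_space)
  qed
  then show ?thesis
    unfolding indep_rv_def by (auto intro!: W.indep_setI m simp: sets)
qed

text \<open>The witnesses are \<open>N \<Otimes>\<^sub>M P\<close> with \<open>P\<close> an infinite
  product of Bernoulli laws, the projection \<open>fst\<close>, and the coordinates of the second
  component.\<close>

lemma ex_bernoulli_extension:
  fixes N :: "'b measure" and Y :: "'b \<Rightarrow> nat"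
  assumes "prob_space N" and [measurable]: "Y \<in> N \<rightarrow>\<^sub>M count_space UNIV"
  obtains W :: "('b \<times> (nat \<Rightarrow> nat)) measure" and \<pi> Z
  where "prob_extension W \<pi> N" "iid_bernoulli c W Z"
    "indep_rv W (count_space UNIV) (Y \<circ> \<pi>) (\<Pi>\<^sub>M i\<in>{1..}. count_space UNIV) (\<lambda>\<omega>. \<lambda>i\<in>{1..}. Z i \<omega>)"
proof -
  define B :: "nat measure" where "B = measure_pmf (map_pmf of_bool (bernoulli_pmf c))"
  define P where "P = (\<Pi>\<^sub>M i\<in>{1::nat..}. B)"
  have sets_B [measurable_cong]: "sets B = sets (count_space UNIV)"
    by (simp add: B_def)
  have B: "prob_space B"
    unfolding B_def by (rule prob_space_measure_pmf)
  have sets_P [measurable_cong]: "sets P = sets (\<Pi>\<^sub>M i\<in>{1::nat..}. count_space UNIV)"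
    unfolding P_def by (rule sets_PiM_cong) (auto simp: sets_B)
  interpret N: prob_space N by fact
  interpret P: prob_space P
    unfolding P_def by (intro prob_space_PiM B)
  interpret W: pair_prob_space N P ..
  define Z where "Z i = (\<lambda>\<omega> :: 'b \<times> (nat \<Rightarrow> nat). snd \<omega> i)" for i :: nat
  \<comment> \<open>Points of \<open>P\<close> are already \<open>undefined\<close> at index 0, so
    restricting to \<open>{1..}\<close> changes nothing.\<close>
  have restrict: "(\<lambda>i\<in>{1..}. Z i \<omega>) = snd \<omega>" if "\<omega> \<in> space (N \<Otimes>\<^sub>M P)" for \<omega>
    using that by (auto simp: Z_def space_pair_measure P_def space_PiM PiE_restrict)
  have distr_snd: "distr (N \<Otimes>\<^sub>M P) P snd = P"
  proof (rule measure_eqI)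
    fix A assume "A \<in> sets (distr (N \<Otimes>\<^sub>M P) P snd)"
    then have A [measurable]: "A \<in> sets P"
      by simp
    then have "snd -` A \<inter> space (N \<Otimes>\<^sub>M P) = space N \<times> A"
      using sets.sets_into_space[OF A] by (auto simp: space_pair_measure)
    then show "emeasure (distr (N \<Otimes>\<^sub>M P) P snd) A = emeasure P A"
      by (simp add: emeasure_distr P.emeasure_pair_measure_Times N.emeasure_space_1)
  qed simp
  have Z_meas: "Z i \<in> N \<Otimes>\<^sub>M P \<rightarrow>\<^sub>M count_space UNIV" if "i \<in> {1..}" for i
    unfolding Z_def using that by measurable
  have distr_Z: "distr (N \<Otimes>\<^sub>M P) (count_space UNIV) (Z i) = B" if "i \<in> {1..}" for i
  proof -
    have "distr (N \<Otimes>\<^sub>M P) (count_space UNIV) (Z i)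
        = distr (distr (N \<Otimes>\<^sub>M P) P snd) (count_space UNIV) (\<lambda>z. z i)"
      unfolding Z_def using that by (subst distr_distr) (auto simp: comp_def)
    also have "\<dots> = distr P B (\<lambda>z. z i)"
      unfolding distr_snd by (rule distr_cong) (simp_all add: sets_B)
    also have "\<dots> = B"
      unfolding P_def using that B by (intro distr_PiM_component) auto
    finally show ?thesis .
  qed
  \<comment> \<open>Independence means that the joint law is the product of the marginals: the joint
    law is that of \<open>snd\<close>, namely \<open>P\<close>, and each marginal is
    \<open>B\<close>.\<close>
  have "W.indep_vars (\<lambda>_. count_space UNIV) Z {1..}"
  proof (subst W.indep_vars_iff_distr_eq_PiM')
    have "distr (N \<Otimes>\<^sub>M P) (\<Pi>\<^sub>M i\<in>{1..}. count_space UNIV) (\<lambda>\<omega>. \<lambda>i\<in>{1..}. Z i \<omega>)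
        = distr (N \<Otimes>\<^sub>M P) P snd"
      by (rule distr_cong) (simp_all add: restrict sets_P del: One_nat_def)
    also have "\<dots> = (\<Pi>\<^sub>M i\<in>{1..}. distr (N \<Otimes>\<^sub>M P) (count_space UNIV) (Z i))"
      unfolding distr_snd by (subst P_def, rule PiM_cong) (simp_all add: distr_Z)
    finally show "distr (N \<Otimes>\<^sub>M P) (\<Pi>\<^sub>M i\<in>{1..}. count_space UNIV) (\<lambda>\<omega>. \<lambda>i\<in>{1..}. Z i \<omega>) = \<dots>" .
  qed (use Z_meas in auto)
  then have "iid_bernoulli c (N \<Otimes>\<^sub>M P) Z"
    using distr_Z by (auto simp: iid_bernoulli_def B_def)
  moreover have "prob_extension (N \<Otimes>\<^sub>M P) fst N"
    unfolding prob_extension_def by (auto simp: P.distr_pair_fst W.prob_space_axioms)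
  moreover have "indep_rv (N \<Otimes>\<^sub>M P) (count_space UNIV) (Y \<circ> fst)
      (\<Pi>\<^sub>M i\<in>{1..}. count_space UNIV) (\<lambda>\<omega>. \<lambda>i\<in>{1..}. Z i \<omega>)"
  proof -
    have "indep_rv (N \<Otimes>\<^sub>M P) (count_space UNIV) (\<lambda>\<omega>. Y (fst \<omega>))
        (\<Pi>\<^sub>M i\<in>{1..}. count_space UNIV) (\<lambda>\<omega>. snd \<omega>)"
      by (rule indep_rv_pair_measure[OF assms(1) P.prob_space_axioms assms(2)
          measurable_ident_sets[OF sets_P]])
    \<comment> \<open>\<open>restrict\<close> holds only on the space, so independence is carried
      from \<open>snd\<close> to the sequence through measurability and the generated sigma-algebra,
      which see no other points.\<close>
    moreover have "(\<lambda>\<omega>. \<lambda>i\<in>{1..}. Z i \<omega>) \<in> N \<Otimes>\<^sub>M P \<rightarrow>\<^sub>M (\<Pi>\<^sub>M i\<in>{1..}. count_space UNIV) \<longleftrightarrow>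
        snd \<in> N \<Otimes>\<^sub>M P \<rightarrow>\<^sub>M (\<Pi>\<^sub>M i\<in>{1..}. count_space UNIV)"
      by (rule measurable_cong) (rule restrict)
    moreover have "vimage_algebra (space (N \<Otimes>\<^sub>M P)) (\<lambda>\<omega>. \<lambda>i\<in>{1..}. Z i \<omega>) (\<Pi>\<^sub>M i\<in>{1..}. count_space UNIV)
        = vimage_algebra (space (N \<Otimes>\<^sub>M P)) snd (\<Pi>\<^sub>M i\<in>{1..}. count_space UNIV)"
      by (rule vimage_algebra_cong[OF refl restrict refl])
    ultimately show ?thesis
      unfolding indep_rv_def comp_def by simp
  qed
  ultimately show thesis
    by (intro that)
qed

text \<open>The equivalence fixes a carrier large enough for the product construction. The second
  conjunct shows that a representation over any other carrier type \<open>'w\<close> implies the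
  D-type identity as well, so this choice loses nothing.\<close>

theorem theorem3p2:
  fixes M :: "'a measure" and N :: "'b measure"
    and X :: "'a \<Rightarrow> nat" and Y :: "'b \<Rightarrow> nat" and c :: real
  assumes "prob_space M" and "prob_space N"
    and "X \<in> M \<rightarrow>\<^sub>M count_space UNIV" and "Y \<in> N \<rightarrow>\<^sub>M count_space UNIV"
    and "0 < c" and "c < 1"
  shows "(same_D_type c M X N Y \<longleftrightarrow>
            (\<exists>(W :: ('b \<times> (nat \<Rightarrow> nat)) measure) \<pi>.
               prob_extension W \<pi> N \<and> bernoulli_sum_repr c M X W (Y \<circ> \<pi>)))
       \<and> ((\<exists>(W :: 'w measure) \<pi>.
               prob_extension W \<pi> N \<and> bernoulli_sum_repr c M X W (Y \<circ> \<pi>))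
            \<longrightarrow> same_D_type c M X N Y)"
proof (intro conjI iffI impI)
  assume D: "same_D_type c M X N Y"
  obtain W :: "('b \<times> (nat \<Rightarrow> nat)) measure" and \<pi> Z
    where ext: "prob_extension W \<pi> N" and Z: "iid_bernoulli c W Z"
      "indep_rv W (count_space UNIV) (Y \<circ> \<pi>) (\<Pi>\<^sub>M i\<in>{1..}. count_space UNIV) (\<lambda>\<omega>. \<lambda>i\<in>{1..}. Z i \<omega>)"
    using ex_bernoulli_extension[OF assms(2,4)] by blast
  interpret W: prob_space W
    using ext by (simp add: prob_extension_def)
  have "distr M (count_space UNIV) X =
      distr W (count_space UNIV) (\<lambda>\<omega>. \<Sum>i = 1..(Y \<circ> \<pi>) \<omega>. Z i \<omega>)"
  proof (rule pgf_eq_imp_distr_eq)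
    fix t :: real assume t: "0 < t" "t < 1"
    \<comment> \<open>The D-type identity at s = 1 - t, which again lies in (0,1).\<close>
    have "pgf M X t = pgf N Y (1 - c * (1 - t))"
      using D t by (auto simp: same_D_type_def dest!: spec[of _ "1 - t"])
    also have "\<dots> = pgf W (\<lambda>\<omega>. \<Sum>i = 1..(Y \<circ> \<pi>) \<omega>. Z i \<omega>) t"
      using W.pgf_bernoulli_random_sum[OF Z] assms t
      by (simp add: pgf_prob_extension[OF ext assms(4)] algebra_simps)
    finally show "pgf M X t = pgf W (\<lambda>\<omega>. \<Sum>i = 1..(Y \<circ> \<pi>) \<omega>. Z i \<omega>) t" .
  qed (use assms W.prob_space_axioms W.measurable_bernoulli_random_sum[OF Z] in auto)
  then show "\<exists>(W :: ('b \<times> (nat \<Rightarrow> nat)) measure) \<pi>.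
      prob_extension W \<pi> N \<and> bernoulli_sum_repr c M X W (Y \<circ> \<pi>)"
    using ext Z unfolding bernoulli_sum_repr_def by blast
qed (use bernoulli_sum_repr_imp_same_D_type assms in blast)+

end
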